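(* For every computation $M$ of $\lambda_{\copyright}$, the following are equivalent: (1) $M \to_{\copyright}^* !V$ for some value $V$; (2) the (unique) maximal $\to^{\mathsf w}_{\beta_c}$-sequence from $M$ is finite and ends in a term of the form $!W$; (3) the (unique) maximal $\mapsto_{\beta_c\sigma}$-sequence from $M$ is finite and ends in a term of the form $!W$.
   Context: The computational core $\lambda_{\copyright}$ has values $V,W ::= x \mid \lambda x.M$ and computations $M,N,L ::= \,!V \mid VM$ ($x$ ranging over a countable set of variables, terms up to $\alpha$-renaming; $M\{V/x\}$ is capture-avoiding substitution). Root rules on computations: $\beta_c$: $(\lambda x.M)(!V) \mapsto M\{V/x\}$; $\mathsf{id}$: $(\lambda x.!x)M \mapsto M$; $\sigma$: $(\lambda y.N)((\lambda x.M)L) \mapsto (\lambda x.(\lambda y.N)M)L$ provided $x\notin \mathrm{fv}(N)$; $\copyright=\beta_c\cup\mathsf{id}\cup\sigma$; $\mapsto_{\beta_c\sigma} = \mapsto_{\beta_c}\cup\mapsto_{\sigma}$ is the union of the root rules themselves (no contextual closure), which is a deterministic relation. Contexts: $C ::= [\,] \mid\, !(\lambda x.C) \mid VC \mid (\lambda x.C)M$; weak contexts: $W ::= [\,]\mid VW$. $\to_\rho$ is the closure of rule $\rho$ under all contexts, and $\to^{\mathsf w}_\rho$ its closure under weak contexts; $\to^{\mathsf w}_{\beta_c}$ is deterministic. $\to^*$ is reflexive–transitive closure. *)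

theory Defs
  imports Main
begin

(* Terms up to alpha-renaming are represented by de Bruijn indices. *)

datatype val = Var nat | Abs comp
  and comp = Ret val | App val comp

primrec lift_val :: "val \<Rightarrow> nat \<Rightarrow> val"
  and lift_comp :: "comp \<Rightarrow> nat \<Rightarrow> comp" where
  "lift_val (Var i) k = (if i < k then Var i else Var (Suc i))"
| "lift_val (Abs M) k = Abs (lift_comp M (Suc k))"
| "lift_comp (Ret V) k = Ret (lift_val V k)"
| "lift_comp (App V M) k = App (lift_val V k) (lift_comp M k)"

(* The binder of index k is removed, so indices above k are decremented. *)

primrec subst_val :: "val \<Rightarrow> val \<Rightarrow> nat \<Rightarrow> val"
  and subst_comp :: "comp \<Rightarrow> val \<Rightarrow> nat \<Rightarrow> comp" where
  "subst_val (Var i) U k =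
     (if i < k then Var i else if i = k then U else Var (i - 1))"
| "subst_val (Abs M) U k = Abs (subst_comp M (lift_val U 0) (Suc k))"
| "subst_comp (Ret V) U k = Ret (subst_val V U k)"
| "subst_comp (App V M) U k = App (subst_val V U k) (subst_comp M U k)"

inductive beta_c :: "comp \<Rightarrow> comp \<Rightarrow> bool" where
  "beta_c (App (Abs M) (Ret V)) (subst_comp M V 0)"

inductive id_rule :: "comp \<Rightarrow> comp \<Rightarrow> bool" where
  "id_rule (App (Abs (Ret (Var 0))) M) M"

(* Lifting Abs N under the binder of M expresses the side condition that the
   variable bound there is not free in N. *)

inductive sigma :: "comp \<Rightarrow> comp \<Rightarrow> bool" where
  "sigma (App (Abs N) (App (Abs M) L))
         (App (Abs (App (lift_val (Abs N) 0) M)) L)"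

definition beta_sigma :: "comp \<Rightarrow> comp \<Rightarrow> bool" where
  "beta_sigma M N \<longleftrightarrow> beta_c M N \<or> sigma M N"

definition core_rule :: "comp \<Rightarrow> comp \<Rightarrow> bool" where
  "core_rule M N \<longleftrightarrow> beta_c M N \<or> id_rule M N \<or> sigma M N"

datatype ctx = Hole | CRetAbs ctx | CAppArg val ctx | CAppAbs ctx comp

(* Plugging captures variables, as usual for contexts. *)

primrec plug :: "ctx \<Rightarrow> comp \<Rightarrow> comp" where
  "plug Hole M = M"
| "plug (CRetAbs C) M = Ret (Abs (plug C M))"
| "plug (CAppArg V C) M = App V (plug C M)"
| "plug (CAppAbs C N) M = App (Abs (plug C M)) N"

datatype wctx = WHole | WAppArg val wctx

primrec wplug :: "wctx \<Rightarrow> comp \<Rightarrow> comp" where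
  "wplug WHole M = M"
| "wplug (WAppArg V W) M = App V (wplug W M)"

inductive ctx_closure :: "(comp \<Rightarrow> comp \<Rightarrow> bool) \<Rightarrow> comp \<Rightarrow> comp \<Rightarrow> bool"
  for R where
  "R M N \<Longrightarrow> ctx_closure R (plug C M) (plug C N)"

inductive weak_closure :: "(comp \<Rightarrow> comp \<Rightarrow> bool) \<Rightarrow> comp \<Rightarrow> comp \<Rightarrow> bool"
  for R where
  "R M N \<Longrightarrow> weak_closure R (wplug W M) (wplug W N)"

(* A finite or infinite sequence is a function s on the naturals: s n is Some of
   the n-th term, and None beyond the end of the sequence. *)

definition maximal_seq :: "('a \<Rightarrow> 'a \<Rightarrow> bool) \<Rightarrow> 'a \<Rightarrow> (nat \<Rightarrow> 'a option) \<Rightarrow> bool" where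
  "maximal_seq R a s \<longleftrightarrow> s 0 = Some a \<and>
     (\<forall>n. case s n of
        None \<Rightarrow> s (Suc n) = None
      | Some b \<Rightarrow> (case s (Suc n) of
            None \<Rightarrow> \<not> (\<exists>c. R b c)
          | Some c \<Rightarrow> R b c))"

definition ends_in :: "(nat \<Rightarrow> 'a option) \<Rightarrow> 'a \<Rightarrow> bool" where
  "ends_in s b \<longleftrightarrow> (\<exists>n. s n = Some b \<and> s (Suc n) = None)"

end

theory Submission
  imports Defs
begin

(* All three conditions are equivalent to convergence of a big-step evaluation M evaluates to V,
   defined on open terms.  For reduction under arbitrary contexts the point is that a root step
   preserves the resulting value exactly, in both directions.  So let a parallel step be an optional
   root step at the head followed by parallel steps in the immediate subterms; it is stable under
   substitution and, by induction on evaluation, reflects convergence. *)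

section \<open>Substitution in de Bruijn terms\<close>

lemma lift_lift:
  "i < Suc k \<Longrightarrow> lift_val (lift_val V i) (Suc k) = lift_val (lift_val V k) i"
  "i < Suc k \<Longrightarrow> lift_comp (lift_comp M i) (Suc k) = lift_comp (lift_comp M k) i"
  by (induction V and M arbitrary: i k and i k) auto

lemma lift_subst:
  "j < Suc i \<Longrightarrow>
     lift_val (subst_val V U j) i = subst_val (lift_val V (Suc i)) (lift_val U i) j"
  "j < Suc i \<Longrightarrow>
     lift_comp (subst_comp M U j) i = subst_comp (lift_comp M (Suc i)) (lift_val U i) j"
  by (induction V and M arbitrary: i j U and i j U) (auto simp: lift_lift split: nat.split)

lemma lift_subst_below:
  "i < Suc j \<Longrightarrow>
     lift_val (subst_val V U j) i = subst_val (lift_val V i) (lift_val U i) (Suc j)"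
  "i < Suc j \<Longrightarrow>
     lift_comp (subst_comp M U j) i = subst_comp (lift_comp M i) (lift_val U i) (Suc j)"
  by (induction V and M arbitrary: i j U and i j U) (auto simp: lift_lift)

lemma subst_lift [simp]:
  "subst_val (lift_val V k) U k = V"
  "subst_comp (lift_comp M k) U k = M"
  by (induction V and M arbitrary: k U and k U) auto

text \<open>The substitution lemma M{U/y}{U'{U/y}/x} = M{U'/x}{U/y}; \<open>lift_val U i\<close>
  encodes that x is not free in U. It makes \<open>beta_c\<close> stable under substitution.\<close>

lemma subst_subst:
  "i < Suc j \<Longrightarrow>
     subst_val (subst_val V (lift_val U i) (Suc j)) (subst_val U' U j) i
     = subst_val (subst_val V U' i) U j"
  "i < Suc j \<Longrightarrow>
     subst_comp (subst_comp M (lift_val U i) (Suc j)) (subst_val U' U j) i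
     = subst_comp (subst_comp M U' i) U j"
  by (induction V and M arbitrary: i j U U' and i j U U')
     (auto simp: lift_lift [symmetric] lift_subst_below)

lemma core_rule_lift: "core_rule M N \<Longrightarrow> core_rule (lift_comp M k) (lift_comp N k)"
  by (auto simp: core_rule_def beta_c.simps id_rule.simps sigma.simps lift_subst lift_lift)

lemma core_rule_subst: "core_rule M N \<Longrightarrow> core_rule (subst_comp M U k) (subst_comp N U k)"
  by (auto simp: core_rule_def beta_c.simps id_rule.simps sigma.simps
      subst_subst(2) [where i = 0, symmetric] lift_subst_below lift_lift)

section \<open>Evaluation\<close>

text \<open>The function position already holds a value, so only the argument is evaluated. An
  application headed by a variable is stuck: no rule covers it.\<close>

inductive evaluates :: "comp \<Rightarrow> val \<Rightarrow> bool" where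
  Ret: "evaluates (Ret V) V"
| App: "evaluates L U \<Longrightarrow> evaluates (subst_comp M U 0) V \<Longrightarrow> evaluates (App (Abs M) L) V"

inductive_simps evaluates_simps [simp]:
  "evaluates (Ret V) U" "evaluates (App (Abs M) L) U" "evaluates (App (Var i) L) U"

text \<open>For \<open>id_rule\<close> the value of the argument is returned unchanged. For
  \<open>sigma\<close> both sides evaluate the same pieces in the same order, since substitution
  cancels the lift (\<open>subst_lift\<close>).\<close>

lemma core_rule_evaluates: "core_rule M N \<Longrightarrow> evaluates N V \<Longrightarrow> evaluates M V"
  by (fastforce simp: core_rule_def beta_c.simps id_rule.simps sigma.simps)

text \<open>Root steps cannot reduce an argument in place; \<open>sigma\<close> instead brings its
  redex to the root by moving the surrounding function inside, as a continuation.\<close>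

lemma evaluates_imp_beta_sigma: "evaluates M V \<Longrightarrow> beta_sigma\<^sup>*\<^sup>* M (Ret V)"
proof -
  \<comment> \<open>The continuation \<open>N\<close> stays arbitrary because the induction
    hypothesis for the inner argument is needed with the composite continuation
    \<open>?F\<close>.\<close>
  have arg: "beta_sigma\<^sup>*\<^sup>* (App (Abs N) L) (App (Abs N) (Ret U))" if "evaluates L U" for L U N
    using that
  proof (induction arbitrary: N rule: evaluates.induct)
    case (Ret V)
    show ?case by simp
  next
    case (App L U M V)
    let ?F = "App (lift_val (Abs N) 0) M"
    have "beta_sigma (App (Abs N) (App (Abs M) L)) (App (Abs ?F) L)"
      unfolding beta_sigma_def by (blast intro: sigma.intros)
    moreover have "beta_sigma\<^sup>*\<^sup>* (App (Abs ?F) L) (App (Abs ?F) (Ret U))"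
      by (rule App.IH)
    \<comment> \<open>Keeping \<open>lift_val\<close> folded lets \<open>subst_lift\<close> cancel
      it, which puts \<open>Abs N\<close> back in function position.\<close>
    moreover have "beta_sigma (App (Abs ?F) (Ret U)) (App (Abs N) (subst_comp M U 0))"
      using beta_c.intros [of ?F U] by (simp add: beta_sigma_def del: lift_val.simps)
    moreover have "beta_sigma\<^sup>*\<^sup>* (App (Abs N) (subst_comp M U 0)) (App (Abs N) (Ret V))"
      by (rule App.IH)
    ultimately show ?case
      by (meson converse_rtranclp_into_rtranclp rtranclp_trans)
  qed
  show "evaluates M V \<Longrightarrow> beta_sigma\<^sup>*\<^sup>* M (Ret V)"
  proof (induction rule: evaluates.induct)
    case (App L U M V)
    have "beta_sigma (App (Abs M) (Ret U)) (subst_comp M U 0)"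
      by (simp add: beta_sigma_def beta_c.intros)
    with arg [OF App.hyps(1), of M] App.IH(2) show ?case
      by (meson converse_rtranclp_into_rtranclp rtranclp_trans)
  qed simp
qed

lemma weak_closure_root: "R M N \<Longrightarrow> weak_closure R M N"
  using weak_closure.intros [of R M N WHole] by simp

lemma weak_closure_App: "weak_closure R M N \<Longrightarrow> weak_closure R (App V M) (App V N)"
  by (metis weak_closure.simps wplug.simps(2))

lemma weak_closure_imp_ctx_closure: "weak_closure R M N \<Longrightarrow> ctx_closure R M N"
proof (induction rule: weak_closure.induct)
  case (1 M N W)
  have "\<exists>C. wplug W = plug C"
  proof (induction W)
    case WHole
    show ?case by (rule exI [of _ Hole]) auto
  next
    case (WAppArg V W)
    then obtain C where "wplug W = plug C" by blast
    then show ?case by (intro exI [of _ "CAppArg V C"]) auto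
  qed
  with 1 show ?case by (metis ctx_closure.intros)
qed

text \<open>Weak contexts reach the argument, so it is reduced in place, without
  \<open>sigma\<close>.\<close>

lemma evaluates_imp_weak_beta:
  "evaluates M V \<Longrightarrow> (weak_closure beta_c)\<^sup>*\<^sup>* M (Ret V)"
proof (induction rule: evaluates.induct)
  case (App L U M V)
  have "(weak_closure beta_c)\<^sup>*\<^sup>* (App (Abs M) L) (App (Abs M) (Ret U))"
    using App.IH(1)
    by (induction rule: rtranclp_induct) (auto intro: rtranclp.rtrancl_into_rtrancl weak_closure_App)
  moreover have "weak_closure beta_c (App (Abs M) (Ret U)) (subst_comp M U 0)"
    by (intro weak_closure_root beta_c.intros)
  ultimately show ?case
    using App.IH(2) by (meson converse_rtranclp_into_rtranclp rtranclp_trans)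
qed simp

section \<open>Parallel reduction\<close>

text \<open>The rules follow the shape of the target, since evaluation is pulled back from target to
  source: inversion undoes at most one root step and then compares subterms.\<close>

inductive par_val :: "val \<Rightarrow> val \<Rightarrow> bool" and par_comp :: "comp \<Rightarrow> comp \<Rightarrow> bool" where
  Var: "par_val (Var i) (Var i)"
| Abs: "par_comp M N \<Longrightarrow> par_val (Abs M) (Abs N)"
| Ret: "core_rule\<^sup>=\<^sup>= M (Ret V) \<Longrightarrow> par_val V V' \<Longrightarrow> par_comp M (Ret V')"
| App: "core_rule\<^sup>=\<^sup>= M (App V L) \<Longrightarrow> par_val V V' \<Longrightarrow> par_comp L L' \<Longrightarrow> par_comp M (App V' L')"

inductive_cases par_val_AbsE: "par_val V (Abs N)"
inductive_cases par_comp_RetE: "par_comp M (Ret V)"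
inductive_cases par_comp_AppE: "par_comp M (App V L)"

lemma par_refl: "par_val V V" "par_comp M M"
  by (induction V and M) (auto intro: par_val_par_comp.intros)

lemma core_rule_imp_par: "core_rule M N \<Longrightarrow> par_comp M N"
  by (cases N) (auto intro: par_val_par_comp.intros par_refl)

lemma ctx_closure_imp_par: "ctx_closure core_rule M N \<Longrightarrow> par_comp M N"
proof (induction rule: ctx_closure.induct)
  case (1 M N C)
  then show ?case
    by (induction C) (auto intro: par_val_par_comp.intros par_refl core_rule_imp_par)
qed

lemma par_lift:
  "par_val V V' \<Longrightarrow> par_val (lift_val V k) (lift_val V' k)"
  "par_comp M M' \<Longrightarrow> par_comp (lift_comp M k) (lift_comp M' k)"
proof (induction arbitrary: k and k rule: par_val_par_comp.inducts)
  case (Ret M V V')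
  then have "core_rule\<^sup>=\<^sup>= (lift_comp M k) (Ret (lift_val V k))"
    using core_rule_lift by fastforce
  with Ret show ?case by (auto intro: par_val_par_comp.Ret)
next
  case (App M V L V' L')
  then have "core_rule\<^sup>=\<^sup>= (lift_comp M k) (App (lift_val V k) (lift_comp L k))"
    using core_rule_lift by fastforce
  with App show ?case by (auto intro: par_val_par_comp.App)
qed (auto intro: par_val_par_comp.intros)

text \<open>The root step precedes the inner ones, so \<open>core_rule_subst\<close> carries it over
  with \<open>U\<close> alone; \<open>U\<close> turns into \<open>U'\<close> only inside the
  subterms.\<close>

lemma par_subst:
  "par_val V V' \<Longrightarrow> par_val U U' \<Longrightarrow> par_val (subst_val V U k) (subst_val V' U' k)"
  "par_comp M M' \<Longrightarrow> par_val U U' \<Longrightarrow> par_comp (subst_comp M U k) (subst_comp M' U' k)"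
proof (induction arbitrary: U U' k and U U' k rule: par_val_par_comp.inducts)
  case (Ret M V V')
  then have "core_rule\<^sup>=\<^sup>= (subst_comp M U k) (Ret (subst_val V U k))"
    using core_rule_subst by fastforce
  with Ret show ?case by (auto intro: par_val_par_comp.Ret)
next
  case (App M V L V' L')
  then have "core_rule\<^sup>=\<^sup>= (subst_comp M U k) (App (subst_val V U k) (subst_comp L U k))"
    using core_rule_subst by fastforce
  with App show ?case by (auto intro: par_val_par_comp.App)
next
  case (Abs M N)
  then show ?case by (simp add: par_val_par_comp.Abs par_lift)
qed (auto intro: par_val_par_comp.intros)

text \<open>Inner steps are undone by induction on the evaluation of the target, the root step by
  \<open>core_rule_evaluates\<close>. Values agree only up to \<open>par_val\<close>, since
  reduction may take place under a lambda.\<close>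

lemma par_reflects_evaluates:
  "evaluates N V' \<Longrightarrow> par_comp M N \<Longrightarrow> \<exists>V. evaluates M V \<and> par_val V V'"
proof (induction arbitrary: M rule: evaluates.induct)
  case (Ret V')
  then obtain V where "core_rule M (Ret V) \<or> M = Ret V" "par_val V V'"
    by (auto elim: par_comp_RetE)
  then show ?case
    using core_rule_evaluates evaluates.Ret by blast
next
  case (App L' U' N V')
  from App.prems obtain F L
    where M: "core_rule M (App F L) \<or> M = App F L"
      and F: "par_val F (Abs N)" and L: "par_comp L L'"
    by (blast elim: par_comp_AppE)
  from F obtain P where P: "F = Abs P" "par_comp P N"
    by (auto elim: par_val_AbsE)
  from App.IH(1) [OF L] obtain U where U: "evaluates L U" "par_val U U'" by blast
  \<comment> \<open>Stability under substitution relates the instantiated bodies even when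
    \<open>U\<close> and \<open>U'\<close> differ.\<close>
  from App.IH(2) [OF par_subst(2) [OF P(2) U(2)]]
  obtain V where "evaluates (subst_comp P U 0) V" "par_val V V'" by blast
  with P U have "evaluates (App F L) V" by auto
  with M \<open>par_val V V'\<close> show ?case using core_rule_evaluates by blast
qed

section \<open>Convergence of the three reductions\<close>

lemma core_reduction_imp_evaluates:
  "(ctx_closure core_rule)\<^sup>*\<^sup>* M (Ret V) \<Longrightarrow> \<exists>U. evaluates M U"
proof (induction rule: converse_rtranclp_induct)
  case base
  show ?case by auto
next
  case (step M N)
  then show ?case by (meson ctx_closure_imp_par par_reflects_evaluates)
qed

lemma ctx_closure_mono: "ctx_closure R M N \<Longrightarrow> R \<le> S \<Longrightarrow> ctx_closure S M N"
  by (auto simp: ctx_closure.simps)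

text \<open>A circle: evaluation is realised by each restricted relation, both of these lie inside
  full contextual reduction, and that in turn reflects evaluation.\<close>

lemma evaluates_iff_core_reduction:
  "(\<exists>V. (ctx_closure core_rule)\<^sup>*\<^sup>* M (Ret V)) \<longleftrightarrow> (\<exists>V. evaluates M V)"
  and evaluates_iff_weak_beta:
  "(\<exists>V. (weak_closure beta_c)\<^sup>*\<^sup>* M (Ret V)) \<longleftrightarrow> (\<exists>V. evaluates M V)"
  and evaluates_iff_beta_sigma:
  "(\<exists>V. beta_sigma\<^sup>*\<^sup>* M (Ret V)) \<longleftrightarrow> (\<exists>V. evaluates M V)"
proof -
  have "weak_closure beta_c \<le> ctx_closure core_rule"
    by (auto intro: ctx_closure_mono weak_closure_imp_ctx_closure simp: core_rule_def le_fun_def)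
  then have weak: "(weak_closure beta_c)\<^sup>*\<^sup>* \<le> (ctx_closure core_rule)\<^sup>*\<^sup>*"
    by (rule rtranclp_mono)
  have "beta_sigma \<le> ctx_closure core_rule"
    using ctx_closure.intros [of core_rule _ _ Hole]
    by (auto simp: core_rule_def beta_sigma_def)
  then have root: "beta_sigma\<^sup>*\<^sup>* \<le> (ctx_closure core_rule)\<^sup>*\<^sup>*"
    by (rule rtranclp_mono)
  show "(\<exists>V. (ctx_closure core_rule)\<^sup>*\<^sup>* M (Ret V)) \<longleftrightarrow> (\<exists>V. evaluates M V)"
    and "(\<exists>V. (weak_closure beta_c)\<^sup>*\<^sup>* M (Ret V)) \<longleftrightarrow> (\<exists>V. evaluates M V)"
    and "(\<exists>V. beta_sigma\<^sup>*\<^sup>* M (Ret V)) \<longleftrightarrow> (\<exists>V. evaluates M V)"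
    using weak root core_reduction_imp_evaluates evaluates_imp_weak_beta evaluates_imp_beta_sigma
    by blast+
qed

section \<open>Maximal sequences\<close>

lemma maximal_seq_Suc_None:
  "maximal_seq R a s \<Longrightarrow> s n = None \<Longrightarrow> s (Suc n) = None"
  by (auto simp: maximal_seq_def dest!: spec [where x = n])

lemma maximal_seq_Suc_normal:
  "maximal_seq R a s \<Longrightarrow> s n = Some b \<Longrightarrow> s (Suc n) = None \<Longrightarrow> \<not> R b c"
  by (auto simp: maximal_seq_def dest!: spec [where x = n])

lemma maximal_seq_Suc_step:
  "maximal_seq R a s \<Longrightarrow> s n = Some b \<Longrightarrow> s (Suc n) = Some c \<Longrightarrow> R b c"
  by (auto simp: maximal_seq_def dest!: spec [where x = n])

lemma maximal_seq_Suc_Some: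
  assumes "right_unique R" "maximal_seq R a s" "s n = Some b" "R b c"
  shows "s (Suc n) = Some c"
proof (cases "s (Suc n)")
  case None
  with assms show ?thesis by (blast dest: maximal_seq_Suc_normal)
next
  case (Some c')
  with assms(2,3) have "R b c'" by (rule maximal_seq_Suc_step)
  with assms(1,4) Some show ?thesis by (simp add: right_uniqueD)
qed

lemma maximal_seq_Suc_end:
  assumes "maximal_seq R a s" "s n = Some b" "\<And>c. \<not> R b c"
  shows "s (Suc n) = None"
  using maximal_seq_Suc_step [OF assms(1,2)] assms(3) by (cases "s (Suc n)") blast+

lemma maximal_seq_exists: "\<exists>s. maximal_seq R a s"
proof
  \<comment> \<open>The witness picks an arbitrary successor until a normal form is reached and is
    \<open>None\<close> from then on.\<close>
  show "maximal_seq R a (rec_nat (Some a) (\<lambda>_ x. case x of None \<Rightarrow> None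
    | Some b \<Rightarrow> if \<exists>c. R b c then Some (SOME c. R b c) else None))"
    unfolding maximal_seq_def by (auto split: option.split intro: someI_ex)
qed

lemma maximal_seq_unique:
  assumes det: "right_unique R" and s: "maximal_seq R a s" and t: "maximal_seq R a t"
  shows "s = t"
proof
  fix n show "s n = t n"
  proof (induction n)
    case 0
    show ?case using s t by (simp add: maximal_seq_def)
  next
    case (Suc n)
    show ?case
    proof (cases "s n")
      case None
      with Suc s t show ?thesis by (simp add: maximal_seq_Suc_None)
    next
      case (Some b)
      with Suc have "t n = Some b" by simp
      show ?thesis
      proof (cases "\<exists>c. R b c")
        case True
        then obtain c where "R b c" by blast
        with \<open>s n = Some b\<close> \<open>t n = Some b\<close> show ?thesis
          by (simp add: maximal_seq_Suc_Some [OF det s] maximal_seq_Suc_Some [OF det t])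
      next
        case False
        with \<open>s n = Some b\<close> \<open>t n = Some b\<close> show ?thesis
          by (simp add: maximal_seq_Suc_end [OF s] maximal_seq_Suc_end [OF t])
      qed
    qed
  qed
qed

lemma maximal_seq_ex1: "right_unique R \<Longrightarrow> \<exists>!s. maximal_seq R a s"
  using maximal_seq_exists [of R a] maximal_seq_unique [of R a] by blast

lemma maximal_seq_reaches:
  assumes s: "maximal_seq R a s"
  shows "s n = Some b \<Longrightarrow> R\<^sup>*\<^sup>* a b"
proof (induction n arbitrary: b)
  case 0
  then show ?case using s by (simp add: maximal_seq_def)
next
  case (Suc n)
  then obtain c where "s n = Some c"
    using maximal_seq_Suc_None [OF s] by (cases "s n") auto
  with Suc show ?case
    using maximal_seq_Suc_step [OF s] by (meson rtranclp.rtrancl_into_rtrancl)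
qed

text \<open>By determinism every reduction from \<open>a\<close> runs along the maximal sequence,
  which therefore meets \<open>b\<close> and stops there because \<open>b\<close> is normal.\<close>

lemma maximal_seq_ends_in_iff:
  assumes det: "right_unique R" and normal: "\<And>c. \<not> R b c"
  shows "(\<exists>s. maximal_seq R a s \<and> ends_in s b) \<longleftrightarrow> R\<^sup>*\<^sup>* a b"
proof
  assume "\<exists>s. maximal_seq R a s \<and> ends_in s b"
  then show "R\<^sup>*\<^sup>* a b" by (auto simp: ends_in_def intro: maximal_seq_reaches)
next
  assume "R\<^sup>*\<^sup>* a b"
  obtain s where s: "maximal_seq R a s" using maximal_seq_exists [of R a] by blast
  have "\<exists>n. s n = Some b" using \<open>R\<^sup>*\<^sup>* a b\<close>
  proof (induction rule: rtranclp_induct)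
    case base
    show ?case using s by (auto simp: maximal_seq_def)
  next
    case (step b c)
    then show ?case using maximal_seq_Suc_Some [OF det s] by blast
  qed
  then obtain n where n: "s n = Some b" by blast
  have "s (Suc n) = None"
    by (rule maximal_seq_Suc_end [OF s n normal])
  with s n show "\<exists>s. maximal_seq R a s \<and> ends_in s b" by (auto simp: ends_in_def)
qed

section \<open>Determinism\<close>

text \<open>The redexes of the two rules do not overlap: the argument is a \<open>Ret\<close> for
  \<open>beta_c\<close> and an \<open>App\<close> for \<open>sigma\<close>.\<close>

lemma beta_sigma_right_unique: "right_unique beta_sigma"
  by (auto simp: right_unique_def beta_sigma_def beta_c.simps sigma.simps)

lemma beta_sigma_Ret: "\<not> beta_sigma (Ret V) N"
  by (auto simp: beta_sigma_def beta_c.simps sigma.simps)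

text \<open>Trades plugging into weak contexts for recursion on the argument, which suits induction
  on the term.\<close>

lemma weak_beta_cases:
  assumes "weak_closure beta_c M N"
  obtains (root) P U where "M = App (Abs P) (Ret U)" "N = subst_comp P U 0"
  | (arg) V L L' where "M = App V L" "N = App V L'" "weak_closure beta_c L L'"
  using assms
proof (cases rule: weak_closure.cases)
  case (1 M' N' W)
  show ?thesis
  proof (cases W)
    case WHole
    with 1 show ?thesis by (auto simp: beta_c.simps intro: root)
  next
    case (WAppArg V W')
    with 1 show ?thesis by (auto intro: arg weak_closure.intros)
  qed
qed

lemma weak_beta_Ret: "\<not> weak_closure beta_c (Ret V) N"
  by (auto elim: weak_beta_cases)

text \<open>The argument of a root redex is a \<open>Ret\<close>, which has no weak step; so two
  steps are both at the root or both in the argument, where induction applies.\<close>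

lemma weak_beta_right_unique: "right_unique (weak_closure beta_c)"
proof (rule right_uniqueI)
  fix M N N' assume "weak_closure beta_c M N" "weak_closure beta_c M N'"
  then show "N = N'"
  proof (induction M arbitrary: N N' rule: measure_induct_rule [where f = size])
    case (less M)
    from less.prems(1) show ?case
    proof (cases rule: weak_beta_cases)
      case (root P U)
      with less.prems(2) show ?thesis by (auto elim: weak_beta_cases simp: weak_beta_Ret)
    next
      case (arg V L L')
      from less.prems(2) show ?thesis
      proof (cases rule: weak_beta_cases)
        case (root P U)
        with arg show ?thesis using weak_beta_Ret by blast
      next
        case arg': (arg V' K K')
        with arg less.IH [of L] show ?thesis by auto
      qed
    qed
  qed
qed

theorem mainTheorem2:
  fixes M :: comp
  shows "(\<exists>!s. maximal_seq (weak_closure beta_c) M s) \<and>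
    (\<exists>!s. maximal_seq beta_sigma M s) \<and>
    ((\<exists>V. (ctx_closure core_rule)\<^sup>*\<^sup>* M (Ret V)) \<longleftrightarrow>
      (\<exists>s W. maximal_seq (weak_closure beta_c) M s \<and> ends_in s (Ret W))) \<and>
    ((\<exists>s W. maximal_seq (weak_closure beta_c) M s \<and> ends_in s (Ret W)) \<longleftrightarrow>
      (\<exists>s W. maximal_seq beta_sigma M s \<and> ends_in s (Ret W)))"
proof -
  \<comment> \<open>\<open>Ret W\<close> is normal for either relation, so ending there amounts to
    reaching it.\<close>
  have "(\<exists>s W. maximal_seq (weak_closure beta_c) M s \<and> ends_in s (Ret W))
      \<longleftrightarrow> (\<exists>W. (weak_closure beta_c)\<^sup>*\<^sup>* M (Ret W))"
    using maximal_seq_ends_in_iff [OF weak_beta_right_unique weak_beta_Ret] by blast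
  moreover have "(\<exists>s W. maximal_seq beta_sigma M s \<and> ends_in s (Ret W))
      \<longleftrightarrow> (\<exists>W. beta_sigma\<^sup>*\<^sup>* M (Ret W))"
    using maximal_seq_ends_in_iff [OF beta_sigma_right_unique beta_sigma_Ret] by blast
  ultimately show ?thesis
    using maximal_seq_ex1 [OF weak_beta_right_unique] maximal_seq_ex1 [OF beta_sigma_right_unique]
    by (simp add: evaluates_iff_core_reduction evaluates_iff_weak_beta evaluates_iff_beta_sigma)
qed

end
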